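(* Let $\Omega\subset X$ be a $\nu$-measurable set with $0<\nu(\Omega)<\nu(X)$. (i) If there exists $\lambda>0$ such that $0\in M(\chi_\Omega,\lambda)$, then there exists $\lambda^0(\Omega)$ satisfying $0<\lambda^0(\Omega)\le h_1^m(\Omega)$ and $$\begin{cases}\mathrm{med}_\nu(\chi_\Omega)=M(\chi_\Omega,\lambda)&\text{if }0<\lambda<\lambda^0(\Omega),\\ 0\in M(\chi_\Omega,\lambda^0(\Omega)),&\\ 0\notin M(\chi_\Omega,\lambda)&\text{if }\lambda>\lambda^0(\Omega).\end{cases}$$ (ii) If there exists $\lambda>0$ such that $1\in M(\chi_\Omega,\lambda)$, then there exists $\lambda^1(\Omega)$ satisfying $0<\lambda^1(\Omega)\le h_1^m(X\setminus\Omega)$ and $$\begin{cases}\mathrm{med}_\nu(\chi_\Omega)=M(\chi_\Omega,\lambda)&\text{if }0<\lambda<\lambda^1(\Omega),\\ 1\in M(\chi_\Omega,\lambda^1(\Omega)),&\\ 1\notin M(\chi_\Omega,\lambda)&\text{if }\lambda>\lambda^1(\Omega).\end{cases}$$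
   Context: Setting: $(X,d)$ is a Polish metric space with its Borel $\sigma$-algebra. A random walk $m=(m_x)_{x\in X}$ on $X$ is a family of Borel probability measures on $X$ such that $x\mapsto m_x(A)$ is Borel for every Borel $A\subset X$ and $\int_X d(z,y)\,dm_x(y)<\infty$ for all $x\in X$ and some (hence any) $z\in X$; $[X,d,m]$ is a metric random walk space. $\nu$ is a finite (nonzero) Radon measure on $X$ which is reversible for $m$: $dm_x(y)d\nu(x)=dm_y(x)d\nu(y)$ as measures on $X\times X$ (this implies invariance, $\nu(A)=\int_X m_x(A)\,d\nu(x)$). It is also assumed that $\frac1{\nu(X)}\nu$ is ergodic with respect to $m$: every Borel set $B$ with $m_x(B)=1$ for all $x\in B$ satisfies $\nu(B)=0$ or $\nu(B)=\nu(X)$. $m$-total variation: $TV_m(u)=\frac12\int_X\int_X|u(y)-u(x)|\,dm_x(y)\,d\nu(x)$. $m$-perimeter: $P_m(E)=\int_E\int_{X\setminus E}dm_x(y)\,d\nu(x)$. For $0<\nu(\Omega)<\nu(X)$, the $m$-Cheeger constant is $h_1^m(\Omega)=\inf\left\{\frac{P_m(E)}{\nu(E)}:E\subset\Omega,\ E\ \nu\text{-measurable},\ \nu(E)>0\right\}$. $\mathcal E_m(u,f,\lambda)=TV_m(u)+\lambda\int_X|u-f|\,d\nu$, and $M(f,\lambda)$ is the set of $u\in L^1(X,\nu)$ minimizing $\mathcal E_m(\cdot,f,\lambda)$ over $L^1(X,\nu)$. A number $\mu\in\mathbb R$ is a median of $u$ if $\nu(\{u<\mu\})\le\frac12\nu(X)$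 and $\nu(\{u>\mu\})\le\frac12\nu(X)$; $\mathrm{med}_\nu(u)$ is the set of all medians of $u$. A constant $c$ is identified with the constant function $c\chi_X$, so $\mathrm{med}_\nu(u)$ is also regarded as a set of constant functions. *)

theory Defs
  imports "HOL-Probability.Probability"
begin

text \<open>
  The space \<open>(X, d)\<close> is a type of class \<open>polish_space\<close> with its Borel sets. The measure
  \<open>\<nu>\<close> is defined on the Borel sets; to admit \<open>\<nu>\<close>-measurable sets and
  functions, everything below is formulated for \<open>completion \<nu>\<close>. Accordingly \<open>m x\<close> is
  completed too: as \<open>\<nu>\<close> is invariant, a \<open>\<nu>\<close>-null set is contained in a Borel set that
  is \<open>m x\<close>-null for \<open>\<nu>\<close>-almost every \<open>x\<close>, so a \<open>\<nu>\<close>-measurable set or function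
  is \<open>completion (m x)\<close>-measurable for \<open>\<nu>\<close>-almost every \<open>x\<close>. On Borel sets and
  functions the completions change nothing.
\<close>

text \<open>
  Membership in \<open>borel \<rightarrow>\<^sub>M prob_algebra borel\<close> says that each \<open>m x\<close> is a Borel
  probability measure and that \<open>x \<mapsto> m x A\<close> is Borel for every Borel \<open>A\<close>.
\<close>

definition random_walk :: "('a::polish_space \<Rightarrow> 'a measure) \<Rightarrow> bool" where
  "random_walk m \<longleftrightarrow>
     m \<in> borel \<rightarrow>\<^sub>M prob_algebra borel \<and>
     (\<exists>z. \<forall>x. (\<integral>\<^sup>+ y. ennreal (dist z y) \<partial>m x) < \<infinity>)"

text \<open>
  Equality of the two measures on \<open>X \<times> X\<close>, evaluated on product-measurable sets.
\<close>

definition reversible :: "('a::polish_space \<Rightarrow> 'a measure) \<Rightarrow> 'a measure \<Rightarrow> bool" where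
  "reversible m \<nu> \<longleftrightarrow>
     (\<forall>C \<in> sets (borel \<Otimes>\<^sub>M borel).
        (\<integral>\<^sup>+ x. (\<integral>\<^sup>+ y. indicator C (x, y) \<partial>m x) \<partial>\<nu>) =
        (\<integral>\<^sup>+ y. (\<integral>\<^sup>+ x. indicator C (x, y) \<partial>m y) \<partial>\<nu>))"

definition ergodic :: "('a::polish_space \<Rightarrow> 'a measure) \<Rightarrow> 'a measure \<Rightarrow> bool" where
  "ergodic m \<nu> \<longleftrightarrow>
     (\<forall>B \<in> sets borel. (\<forall>x\<in>B. emeasure (m x) B = 1) \<longrightarrow>
        emeasure \<nu> B = 0 \<or> emeasure \<nu> B = emeasure \<nu> UNIV)"

text \<open>
  A finite Borel measure on a Polish space is automatically Radon, so no regularity condition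
  is listed for \<open>\<nu>\<close>.
\<close>

definition reversible_ergodic_space ::
    "('a::polish_space \<Rightarrow> 'a measure) \<Rightarrow> 'a measure \<Rightarrow> bool" where
  "reversible_ergodic_space m \<nu> \<longleftrightarrow>
     random_walk m \<and> finite_measure \<nu> \<and> sets \<nu> = sets borel \<and> emeasure \<nu> UNIV \<noteq> 0 \<and>
     reversible m \<nu> \<and> ergodic m \<nu>"

definition total_variation ::
    "('a::polish_space \<Rightarrow> 'a measure) \<Rightarrow> 'a measure \<Rightarrow> ('a \<Rightarrow> real) \<Rightarrow> ennreal" where
  "total_variation m \<nu> u =
     (\<integral>\<^sup>+ x. (\<integral>\<^sup>+ y. ennreal \<bar>u y - u x\<bar> \<partial>completion (m x)) \<partial>completion \<nu>) / 2"

definition perimeter ::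
    "('a::polish_space \<Rightarrow> 'a measure) \<Rightarrow> 'a measure \<Rightarrow> 'a set \<Rightarrow> ennreal" where
  "perimeter m \<nu> E = (\<integral>\<^sup>+ x\<in>E. emeasure (completion (m x)) (UNIV - E) \<partial>completion \<nu>)"

definition cheeger_constant ::
    "('a::polish_space \<Rightarrow> 'a measure) \<Rightarrow> 'a measure \<Rightarrow> 'a set \<Rightarrow> ennreal" where
  "cheeger_constant m \<nu> \<Omega> =
     Inf {perimeter m \<nu> E / emeasure (completion \<nu>) E | E.
            E \<subseteq> \<Omega> \<and> E \<in> sets (completion \<nu>) \<and> 0 < emeasure (completion \<nu>) E}"

text \<open>
  The fidelity parameter is called \<open>\<kappa>\<close> (lambda is reserved). Only \<open>\<kappa> > 0\<close> is
  meaningful, because \<open>ennreal\<close> truncates negative reals to \<open>0\<close>.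
\<close>

definition energy ::
    "('a::polish_space \<Rightarrow> 'a measure) \<Rightarrow> 'a measure \<Rightarrow> ('a \<Rightarrow> real) \<Rightarrow> real \<Rightarrow>
     ('a \<Rightarrow> real) \<Rightarrow> ennreal" where
  "energy m \<nu> f \<kappa> u =
     total_variation m \<nu> u + ennreal \<kappa> * (\<integral>\<^sup>+ x. ennreal \<bar>u x - f x\<bar> \<partial>completion \<nu>)"

text \<open>
  Subsets of \<open>L\<^sup>1(X, \<nu>)\<close> are represented by the set of all representatives of their
  elements, i.e. by sets of integrable functions closed under \<open>\<nu>\<close>-a.e. equality.
\<close>

definition minimizers ::
    "('a::polish_space \<Rightarrow> 'a measure) \<Rightarrow> 'a measure \<Rightarrow> ('a \<Rightarrow> real) \<Rightarrow> real \<Rightarrow>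
     ('a \<Rightarrow> real) set" where
  "minimizers m \<nu> f \<kappa> =
     {u. integrable (completion \<nu>) u \<and>
         (\<forall>v. integrable (completion \<nu>) v \<longrightarrow> energy m \<nu> f \<kappa> u \<le> energy m \<nu> f \<kappa> v)}"

definition medians :: "'a::polish_space measure \<Rightarrow> ('a \<Rightarrow> real) \<Rightarrow> real set" where
  "medians \<nu> u =
     {\<mu>. emeasure (completion \<nu>) {x. u x < \<mu>} \<le> emeasure \<nu> UNIV / 2 \<and>
         emeasure (completion \<nu>) {x. u x > \<mu>} \<le> emeasure \<nu> UNIV / 2}"

text \<open>
  The set of medians regarded as a set of constant elements of \<open>L\<^sup>1(X, \<nu>)\<close>.
\<close>

definition median_functions ::
    "'a::polish_space measure \<Rightarrow> ('a \<Rightarrow> real) \<Rightarrow> ('a \<Rightarrow> real) set" where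
  "median_functions \<nu> u =
     {v. integrable (completion \<nu>) v \<and> (\<exists>c \<in> medians \<nu> u. AE x in completion \<nu>. v x = c)}"

end

theory Submission
  imports Defs
begin

text \<open>
  Let \<open>f\<close> be integrable and write \<open>F u = \<integral> \<bar>u - f\<bar> d\<nu>\<close>. Since constants have no total variation,
  the constant \<open>c\<close> minimizes the energy with parameter \<open>\<kappa>\<close> if and only if
  \<open>\<kappa> * (F c - F v) \<le> TV v\<close> for every integrable \<open>v\<close>. For fixed \<open>v\<close> this holds for all \<open>\<kappa> > 0\<close>
  or exactly for those below or at some bound, and \<open>v = f\<close> does give a bound unless \<open>f = c\<close> almost
  everywhere. So the admissible parameters, if there are any, form
  an interval that contains its right end \<open>\<kappa>0\<close> (lemma \<open>threshold\<close>).

  Below the threshold the minimizers are exactly the medians (lemma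
  \<open>minimizers_eq_median_functions\<close>). If \<open>u\<close> minimizes at \<open>\<kappa> < \<kappa>0\<close>, comparison with \<open>c\<close> at both
  parameters gives \<open>\<kappa>0 * (F c - F u) \<le> TV u \<le> \<kappa> * (F c - F u)\<close>, which forces \<open>F u = F c\<close> and
  \<open>TV u = 0\<close>. By ergodicity \<open>u\<close> is a constant (lemma \<open>AE_const_if_total_variation_0\<close>), and the
  constants that minimize \<open>F\<close> among constants are the medians of \<open>f\<close> (lemma
  \<open>median_iff_minimizes_abs_deviation\<close>).

  For the bound by the Cheeger constant let \<open>f\<close> differ from \<open>c\<close> by \<open>1\<close> on a set \<open>A\<close> and agree
  with \<open>c\<close> elsewhere, always on the same side. The competitor \<open>v\<close> that follows \<open>f\<close> on \<open>E \<subseteq> A\<close>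
  and is \<open>c\<close> elsewhere has \<open>F c - F v = \<nu> E\<close> and \<open>TV v = P E\<close>, so the inequality above reads
  \<open>\<kappa> * \<nu> E \<le> P E\<close>. The two parts of the theorem are the cases \<open>c = 0\<close>, \<open>A = \<Omega>\<close> and \<open>c = 1\<close>,
  \<open>A = UNIV - \<Omega>\<close> of this one argument.
\<close>

section \<open>Medians minimize the mean absolute deviation\<close>

context finite_measure
begin

text \<open>
  With \<open>g x = \<bar>c - f x\<bar>\<close>, the shifted integrand is a bound for \<open>\<bar>c + \<delta> - f x\<bar>\<close>, \<open>\<delta> > 0\<close>: a lower
  bound if \<open>A\<close> is the set where \<open>c < f x\<close>, an upper bound if \<open>A\<close> is the set where
  \<open>c + \<delta> \<le> f x\<close>.
\<close>

lemma integral_add_signed_shift: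
  fixes g :: "'a \<Rightarrow> real"
  assumes g: "integrable M g" and A: "A \<in> sets M"
  shows "integrable M (\<lambda>x. g x + \<delta> * (1 - 2 * indicator A x))"
    and "(\<integral>x. g x + \<delta> * (1 - 2 * indicator A x) \<partial>M) =
      (\<integral>x. g x \<partial>M) + \<delta> * (measure M (space M) - 2 * measure M A)"
proof -
  have A_int: "integrable M (indicator A :: 'a \<Rightarrow> real)"
    using A by (simp add: less_top[symmetric])
  then have shift: "integrable M (\<lambda>x. \<delta> * (1 - 2 * indicator A x) :: real)"
    by (intro integrable_mult_right Bochner_Integration.integrable_diff) auto
  then show "integrable M (\<lambda>x. g x + \<delta> * (1 - 2 * indicator A x))"
    by (rule Bochner_Integration.integrable_add[OF g])
  have "(\<integral>x. 1 - 2 * indicator A x \<partial>M) = measure M (space M) - 2 * measure M A"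
    using A A_int by (subst Bochner_Integration.integral_diff) auto
  then show "(\<integral>x. g x + \<delta> * (1 - 2 * indicator A x) \<partial>M) =
      (\<integral>x. g x \<partial>M) + \<delta> * (measure M (space M) - 2 * measure M A)"
    using Bochner_Integration.integral_add[OF g shift] by simp
qed

text \<open>
  Moving \<open>c\<close> up by \<open>\<delta>\<close> adds \<open>\<delta>\<close> to the distance from \<open>c\<close> to \<open>f x\<close> where
  \<open>f x \<le> c\<close> and removes at most \<open>\<delta>\<close> elsewhere, that is, on at most half of the mass.
\<close>

lemma abs_deviation_mono_above_median:
  fixes f :: "'a \<Rightarrow> real"
  assumes f: "integrable M f"
    and half: "measure M {x \<in> space M. c < f x} \<le> measure M (space M) / 2"
    and "c \<le> d"
  shows "(\<integral>x. \<bar>c - f x\<bar> \<partial>M) \<le> (\<integral>x. \<bar>d - f x\<bar> \<partial>M)"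
proof -
  define A where "A = {x \<in> space M. c < f x}"
  have [measurable]: "f \<in> borel_measurable M" using f by simp
  have A[measurable]: "A \<in> sets M" by (simp add: A_def)
  have "(\<integral>x. \<bar>c - f x\<bar> \<partial>M) + (d - c) * (measure M (space M) - 2 * measure M A)
      = (\<integral>x. \<bar>c - f x\<bar> + (d - c) * (1 - 2 * indicator A x) \<partial>M)"
    using f A by (subst integral_add_signed_shift) auto
  also have "\<dots> \<le> (\<integral>x. \<bar>d - f x\<bar> \<partial>M)"
    using f A \<open>c \<le> d\<close>
    by (intro integral_mono integral_add_signed_shift) (auto simp: A_def split: split_indicator)
  finally have "(\<integral>x. \<bar>c - f x\<bar> \<partial>M) + (d - c) * (measure M (space M) - 2 * measure M A)
      \<le> (\<integral>x. \<bar>d - f x\<bar> \<partial>M)" .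
  moreover have "0 \<le> (d - c) * (measure M (space M) - 2 * measure M A)"
    using half \<open>c \<le> d\<close> by (intro mult_nonneg_nonneg) (auto simp: A_def)
  ultimately show ?thesis by linarith
qed

text \<open>
  Raising \<open>c\<close> to \<open>d > c\<close> lowers the integral by at least \<open>d - c\<close> times the mass of \<open>{d \<le> f}\<close> minus
  that of \<open>{f < d}\<close>. As \<open>c\<close> is optimal, this difference is not positive, so
  \<open>{d \<le> f}\<close> has at most half of the mass; then \<open>d\<close> decreases to \<open>c\<close>.
\<close>

lemma measure_above_le_half_if_minimizes_abs_deviation:
  fixes f :: "'a \<Rightarrow> real"
  assumes f: "integrable M f"
    and min: "\<And>d. c < d \<Longrightarrow> (\<integral>x. \<bar>c - f x\<bar> \<partial>M) \<le> (\<integral>x. \<bar>d - f x\<bar> \<partial>M)"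
  shows "measure M {x \<in> space M. c < f x} \<le> measure M (space M) / 2"
proof -
  have [measurable]: "f \<in> borel_measurable M" using f by simp
  have *: "measure M {x \<in> space M. d \<le> f x} \<le> measure M (space M) / 2" if "c < d" for d
  proof -
    define A where "A = {x \<in> space M. d \<le> f x}"
    have A[measurable]: "A \<in> sets M" by (simp add: A_def)
    have "(\<integral>x. \<bar>c - f x\<bar> \<partial>M) \<le> (\<integral>x. \<bar>d - f x\<bar> \<partial>M)" by (rule min[OF that])
    also have "\<dots> \<le> (\<integral>x. \<bar>c - f x\<bar> + (d - c) * (1 - 2 * indicator A x) \<partial>M)"
      using f A that by (intro integral_mono integral_add_signed_shift) (auto simp: A_def split: split_indicator)
    also have "\<dots> = (\<integral>x. \<bar>c - f x\<bar> \<partial>M) + (d - c) * (measure M (space M) - 2 * measure M A)"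
      using f A by (subst integral_add_signed_shift) auto
    finally show ?thesis
      using that by (simp add: zero_le_mult_iff A_def)
  qed
  define B where "B n = {x \<in> space M. c + 1 / real (Suc n) \<le> f x}" for n
  have "range B \<subseteq> sets M" by (auto simp: B_def)
  moreover have "incseq B"
  proof (rule incseq_SucI)
    fix n
    have "1 / real (Suc (Suc n)) \<le> 1 / real (Suc n)" by (simp add: frac_le)
    then show "B n \<subseteq> B (Suc n)" unfolding B_def by (intro Collect_mono) linarith
  qed
  ultimately have "(\<lambda>n. measure M (B n)) \<longlonglongrightarrow> measure M (\<Union>n. B n)"
    by (rule finite_Lim_measure_incseq)
  moreover have "(\<Union>n. B n) = {x \<in> space M. c < f x}"
  proof (intro set_eqI iffI)
    fix x assume "x \<in> (\<Union>n. B n)"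
    then obtain n where "x \<in> space M" "c + 1 / real (Suc n) \<le> f x" by (auto simp: B_def)
    moreover have "0 < 1 / real (Suc n)" by simp
    ultimately have "x \<in> space M \<and> c < f x" by linarith
    then show "x \<in> {x \<in> space M. c < f x}" by simp
  next
    fix x assume x: "x \<in> {x \<in> space M. c < f x}"
    then obtain n where "1 / real (Suc n) < f x - c"
      using nat_approx_posE[of "f x - c"] by auto
    then have "x \<in> B n" using x unfolding B_def by simp
    then show "x \<in> (\<Union>n. B n)" by blast
  qed
  moreover have "measure M (B n) \<le> measure M (space M) / 2" for n
    unfolding B_def by (rule *) simp
  ultimately show ?thesis by (intro LIMSEQ_le_const2[of "\<lambda>n. measure M (B n)"]) auto
qed

lemma median_iff_minimizes_abs_deviation:
  fixes f :: "'a \<Rightarrow> real"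
  assumes f: "integrable M f"
  shows "measure M {x \<in> space M. f x < c} \<le> measure M (space M) / 2 \<and>
         measure M {x \<in> space M. c < f x} \<le> measure M (space M) / 2 \<longleftrightarrow>
         (\<forall>d. (\<integral>x. \<bar>c - f x\<bar> \<partial>M) \<le> (\<integral>x. \<bar>d - f x\<bar> \<partial>M))"
    (is "?below \<and> ?above \<longleftrightarrow> ?min")
proof (intro iffI conjI allI)
  fix d assume half: "?below \<and> ?above"
  show "(\<integral>x. \<bar>c - f x\<bar> \<partial>M) \<le> (\<integral>x. \<bar>d - f x\<bar> \<partial>M)"
  proof (cases "c \<le> d")
    case True
    then show ?thesis using half by (intro abs_deviation_mono_above_median f) auto
  next
    case False
    \<comment> \<open>Reflection \<open>f \<mapsto> - f\<close> turns the move from \<open>c\<close> down to \<open>d\<close> into a move up.\<close>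
    have "(\<integral>x. \<bar>- c - - f x\<bar> \<partial>M) \<le> (\<integral>x. \<bar>- d - - f x\<bar> \<partial>M)"
      using half False by (intro abs_deviation_mono_above_median) (auto simp: f)
    moreover have "\<bar>- e - - f x\<bar> = \<bar>e - f x\<bar>" for e x by arith
    ultimately show ?thesis by simp
  qed
next
  assume min: ?min
  then show ?above by (intro measure_above_le_half_if_minimizes_abs_deviation f) auto
  have "measure M {x \<in> space M. - c < - f x} \<le> measure M (space M) / 2"
  proof (rule measure_above_le_half_if_minimizes_abs_deviation)
    show "(\<integral>x. \<bar>- c - - f x\<bar> \<partial>M) \<le> (\<integral>x. \<bar>d - - f x\<bar> \<partial>M)" for d
    proof -
      have "\<bar>- c - - f x\<bar> = \<bar>c - f x\<bar>" "\<bar>d - - f x\<bar> = \<bar>- d - f x\<bar>" for x by arith+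
      then show ?thesis using min[rule_format, of "- d"] by simp
    qed
  qed (simp add: f)
  then show ?below by simp
qed

end

section \<open>Invariance, reversibility and ergodicity\<close>

text \<open>
  A set that agrees almost everywhere with a measurable set is measurable for the completion.
  In the perimeter this is applied to \<open>m x\<close>: a set that is measurable for \<open>completion \<nu>\<close>
  is in general measurable for \<open>completion (m x)\<close> only for almost every \<open>x\<close>, and its measure there is that
  of its Borel version.
\<close>

lemma emeasure_completion_eq_AE:
  assumes "AE x in M. x \<in> A \<longleftrightarrow> x \<in> B" "B \<in> sets M" "A \<subseteq> space M"
  shows "emeasure (completion M) A = emeasure M B"
proof -
  have ae: "AE x in completion M. x \<in> B \<longleftrightarrow> x \<in> A"
    using assms(1) by (auto simp: AE_completion_iff elim!: eventually_mono)
  have "A \<in> sets (completion M)"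
    by (rule completion.in_sets_AE[OF ae]) (use assms in auto)
  then have "emeasure (completion M) A = emeasure (completion M) B"
    using ae assms by (intro emeasure_eq_AE) (auto elim!: eventually_mono)
  then show ?thesis using assms by simp
qed

locale ergodic_walk =
  fixes m :: "'a::polish_space \<Rightarrow> 'a measure" and \<nu> :: "'a measure"
  assumes space: "reversible_ergodic_space m \<nu>"
begin

lemma sets_\<nu>[simp, measurable_cong]: "sets \<nu> = sets borel"
  using space by (simp add: reversible_ergodic_space_def)

lemma space_\<nu>[simp]: "space \<nu> = UNIV"
  using sets_eq_imp_space_eq[OF sets_\<nu>] by simp

lemma kernel[measurable]: "m \<in> borel \<rightarrow>\<^sub>M subprob_algebra borel"
  using space
  by (auto simp: reversible_ergodic_space_def random_walk_def intro: measurable_prob_algebraD)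

lemma prob_space_m: "prob_space (m x)"
  using space measurable_space[of m borel "prob_algebra borel" x]
  by (auto simp: reversible_ergodic_space_def random_walk_def space_prob_algebra)

lemma sets_m[simp, measurable_cong]: "sets (m x) = sets borel"
  using sets_kernel[OF kernel] by simp

lemma space_m[simp]: "space (m x) = UNIV"
  using sets_eq_imp_space_eq[OF sets_m] by simp

lemma emeasure_m_UNIV[simp]: "emeasure (m x) UNIV = 1"
  using prob_space.emeasure_space_1[OF prob_space_m, of x] by simp

sublocale finite_measure \<nu>
  using space by (simp add: reversible_ergodic_space_def)

sublocale completion: finite_measure "completion \<nu>"
  by (rule finite_measureI) simp

text \<open>
  On rectangles, reversibility says that equal masses move from \<open>A\<close> to \<open>B\<close> and back:
  \<open>A = UNIV\<close> gives invariance of \<open>\<nu>\<close>, and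
  \<open>B = UNIV - A\<close> shows that a set and its complement have the same perimeter.
\<close>

lemma reversible_Times:
  assumes [measurable]: "A \<in> sets borel" "B \<in> sets borel"
  shows "(\<integral>\<^sup>+x\<in>A. emeasure (m x) B \<partial>\<nu>) = (\<integral>\<^sup>+x\<in>B. emeasure (m x) A \<partial>\<nu>)"
proof -
  have ind: "(\<integral>\<^sup>+y. indicator C y * indicator D x \<partial>m x) = emeasure (m x) C * indicator D x"
    if "C \<in> sets borel" for C D :: "'a set" and x
    using that by (simp add: nn_integral_multc)
  have "A \<times> B \<in> sets (borel \<Otimes>\<^sub>M borel)" by simp
  then have "(\<integral>\<^sup>+x. (\<integral>\<^sup>+y. indicator (A \<times> B) (x, y) \<partial>m x) \<partial>\<nu>) =
      (\<integral>\<^sup>+y. (\<integral>\<^sup>+x. indicator (A \<times> B) (x, y) \<partial>m y) \<partial>\<nu>)"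
    using space unfolding reversible_ergodic_space_def reversible_def by blast
  also have "(\<integral>\<^sup>+x. (\<integral>\<^sup>+y. indicator (A \<times> B) (x, y) \<partial>m x) \<partial>\<nu>) =
      (\<integral>\<^sup>+x\<in>A. emeasure (m x) B \<partial>\<nu>)"
    using ind[where C=B and D=A] by (simp add: indicator_times mult.commute)
  also have "(\<integral>\<^sup>+y. (\<integral>\<^sup>+x. indicator (A \<times> B) (x, y) \<partial>m y) \<partial>\<nu>) =
      (\<integral>\<^sup>+x\<in>B. emeasure (m x) A \<partial>\<nu>)"
    using ind[where C=A and D=B] by (simp add: indicator_times)
  finally show ?thesis .
qed

lemma invariant: "\<nu> \<bind> m = \<nu>"
proof (rule measure_eqI)
  have [simp]: "sets (\<nu> \<bind> m) = sets borel"
    by (rule sets_bind) (auto simp: sets_kernel[OF kernel])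
  then show "sets (\<nu> \<bind> m) = sets \<nu>" by simp
  fix A assume "A \<in> sets (\<nu> \<bind> m)"
  then have A[measurable]: "A \<in> sets borel" by simp
  have "emeasure (\<nu> \<bind> m) A = (\<integral>\<^sup>+x. emeasure (m x) A \<partial>\<nu>)"
    by (rule emeasure_bind[where N=borel]) auto
  also have "\<dots> = emeasure \<nu> A"
    using reversible_Times[of UNIV A] by simp
  finally show "emeasure (\<nu> \<bind> m) A = emeasure \<nu> A" .
qed

lemma nn_integral_invariant:
  assumes [measurable]: "g \<in> borel_measurable borel"
  shows "(\<integral>\<^sup>+x. (\<integral>\<^sup>+y. g y \<partial>m x) \<partial>\<nu>) = (\<integral>\<^sup>+x. g x \<partial>\<nu>)"
proof -
  have "(\<integral>\<^sup>+x. g x \<partial>(\<nu> \<bind> m)) = (\<integral>\<^sup>+x. (\<integral>\<^sup>+y. g y \<partial>m x) \<partial>\<nu>)"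
    by (rule nn_integral_bind[where B=borel]) auto
  then show ?thesis by (simp add: invariant)
qed

text \<open>
  By invariance, a \<open>\<nu>\<close>-null set is \<open>m x\<close>-null for almost every \<open>x\<close>. This makes the total
  variation independent of the representative and allows every function to be replaced by a Borel
  one.
\<close>

lemma AE_kernel:
  assumes "AE x in \<nu>. P x"
  shows "AE x in \<nu>. AE y in m x. P y"
proof -
  obtain N where N: "{x. \<not> P x} \<subseteq> N" "emeasure \<nu> N = 0" and [measurable]: "N \<in> sets borel"
    using assms by (auto elim!: AE_E)
  have "(\<integral>\<^sup>+x. emeasure (m x) N \<partial>\<nu>) = 0"
    using nn_integral_invariant[of "indicator N"] N by simp
  then have "AE x in \<nu>. emeasure (m x) N = 0"
    by (subst (asm) nn_integral_0_iff_AE) auto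
  then show ?thesis
    by eventually_elim (use N in \<open>auto intro!: AE_I[of _ _ N]\<close>)
qed

text \<open>
  Ergodicity is assumed for sets that the walk cannot leave from any of their points. If the walk
  cannot leave \<open>B\<close> from almost every point of \<open>B\<close>, discard the remaining points, then those from
  which the walk may leave what is left, and so on. Every step discards a null set, and the
  intersection \<open>D\<close> of the resulting decreasing sequence \<open>C\<close> cannot be left from any of its points.
\<close>

lemma ergodic_AE:
  assumes [measurable]: "B \<in> sets borel"
    and stay: "AE x in \<nu>. x \<in> B \<longrightarrow> emeasure (m x) B = 1"
  shows "(AE x in \<nu>. x \<notin> B) \<or> (AE x in \<nu>. x \<in> B)"
proof -
  define C where "C = rec_nat B (\<lambda>_ D. {x \<in> D. emeasure (m x) D = 1})"
  have C_0: "C 0 = B" and C_Suc: "C (Suc n) = {x \<in> C n. emeasure (m x) (C n) = 1}" for n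
    by (simp_all add: C_def)
  have C[measurable]: "C n \<in> sets borel" for n
    by (induction n) (simp_all add: C_0 C_Suc)
  have C_B: "AE x in \<nu>. x \<in> C n \<longleftrightarrow> x \<in> B" for n
  proof (induction n)
    case (Suc n)
    have "AE x in \<nu>. emeasure (m x) (C n) = emeasure (m x) B"
      using AE_kernel[OF Suc] by eventually_elim (rule emeasure_eq_AE, auto)
    then show ?case
      using stay Suc by eventually_elim (auto simp: C_Suc)
  qed (simp add: C_0)
  define D where "D = (\<Inter>n. C n)"
  have [measurable]: "D \<in> sets borel" by (simp add: D_def)
  have D_B: "AE x in \<nu>. x \<in> D \<longleftrightarrow> x \<in> B"
  proof -
    have "AE x in \<nu>. \<forall>n. x \<in> C n \<longleftrightarrow> x \<in> B" using C_B by (simp add: AE_all_countable)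
    then show ?thesis by eventually_elim (simp add: D_def)
  qed
  have "emeasure (m x) D = 1" if "x \<in> D" for x
  proof -
    interpret m: prob_space "m x" by (rule prob_space_m)
    have "x \<in> C (Suc n)" for n using that by (simp add: D_def)
    then have "AE y in m x. y \<in> C n" for n
      by (subst m.AE_in_set_eq_1) (auto simp: C_Suc m.emeasure_eq_measure)
    then have "AE y in m x. y \<in> D" by (simp add: D_def AE_all_countable)
    then show ?thesis by (subst (asm) m.AE_in_set_eq_1) (auto simp: m.emeasure_eq_measure)
  qed
  then have "emeasure \<nu> D = 0 \<or> emeasure \<nu> D = emeasure \<nu> UNIV"
    using space by (simp add: reversible_ergodic_space_def ergodic_def)
  then show ?thesis
  proof
    assume "emeasure \<nu> D = 0"
    then have "AE x in \<nu>. x \<notin> D" by (intro AE_not_in) (simp add: null_sets_def)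
    with D_B have "AE x in \<nu>. x \<notin> B" by eventually_elim simp
    then show ?thesis ..
  next
    assume "emeasure \<nu> D = emeasure \<nu> UNIV"
    then have "emeasure \<nu> (UNIV - D) = 0"
      using emeasure_compl[of D \<nu>] by simp
    then have "AE x in \<nu>. x \<in> D"
      by (intro AE_I[of _ _ "UNIV - D"]) auto
    with D_B have "AE x in \<nu>. x \<in> B" by eventually_elim simp
    then show ?thesis ..
  qed
qed

section \<open>Total variation\<close>

lemma total_variation_eq:
  "total_variation m \<nu> u = (\<integral>\<^sup>+x. (\<integral>\<^sup>+y. ennreal \<bar>u y - u x\<bar> \<partial>m x) \<partial>\<nu>) / 2"
  by (simp add: total_variation_def nn_integral_completion)

lemma total_variation_cong_AE:
  assumes "AE x in \<nu>. u x = v x"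
  shows "total_variation m \<nu> u = total_variation m \<nu> v"
proof -
  have "AE x in \<nu>. (\<integral>\<^sup>+y. ennreal \<bar>u y - u x\<bar> \<partial>m x) = (\<integral>\<^sup>+y. ennreal \<bar>v y - v x\<bar> \<partial>m x)"
    using assms AE_kernel[OF assms]
  proof eventually_elim
    case (elim x)
    from elim(2) have "AE y in m x. ennreal \<bar>u y - u x\<bar> = ennreal \<bar>v y - v x\<bar>"
      by eventually_elim (simp add: elim)
    then show ?case by (rule nn_integral_cong_AE)
  qed
  then have "(\<integral>\<^sup>+x. (\<integral>\<^sup>+y. ennreal \<bar>u y - u x\<bar> \<partial>m x) \<partial>\<nu>)
      = (\<integral>\<^sup>+x. (\<integral>\<^sup>+y. ennreal \<bar>v y - v x\<bar> \<partial>m x) \<partial>\<nu>)"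
    by (rule nn_integral_cong_AE)
  then show ?thesis by (simp only: total_variation_eq)
qed

lemma borel_measurable_total_variation_integrand[measurable]:
  assumes [measurable]: "u \<in> borel_measurable borel"
  shows "(\<lambda>x. \<integral>\<^sup>+y. ennreal \<bar>u y - u x :: real\<bar> \<partial>m x) \<in> borel_measurable borel"
  by (rule nn_integral_measurable_subprob_algebra2[where N=borel]) measurable

lemma obtain_borel_version:
  fixes u :: "'a \<Rightarrow> real"
  assumes "u \<in> borel_measurable (completion \<nu>)"
  obtains v where "v \<in> borel_measurable borel" "AE x in \<nu>. u x = v x"
  using completion_ex_borel_measurable_real[OF assms]
  by (auto simp: measurable_cong_sets[OF sets_\<nu> refl])

lemma integrable_borel_version:
  fixes u v :: "'a \<Rightarrow> real"
  assumes "integrable (completion \<nu>) u" "v \<in> borel_measurable borel" "AE x in \<nu>. u x = v x"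
  shows "integrable \<nu> v"
proof -
  have v: "v \<in> borel_measurable \<nu>" using assms(2) by simp
  have "integrable (completion \<nu>) v \<longleftrightarrow> integrable (completion \<nu>) u"
    using assms(1,3) v
    by (intro integrable_cong_AE) (auto simp: AE_completion_iff measurable_completion elim!: eventually_mono)
  then show ?thesis using assms(1) integrable_completion[OF v] by simp
qed

text \<open>
  The total variation is at most the \<open>L\<^sup>1\<close> norm, by the triangle inequality and invariance.
  Hence the energy of an integrable function is a real number, and energies can be subtracted.
\<close>

lemma total_variation_finite:
  assumes u: "integrable (completion \<nu>) u"
  shows "total_variation m \<nu> u < \<infinity>"
proof -
  obtain v where v[measurable]: "v \<in> borel_measurable borel" and uv: "AE x in \<nu>. u x = v x"
    using obtain_borel_version u by blast
  have "(\<integral>\<^sup>+x. (\<integral>\<^sup>+y. ennreal \<bar>v y - v x\<bar> \<partial>m x) \<partial>\<nu>)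
      \<le> (\<integral>\<^sup>+x. (\<integral>\<^sup>+y. ennreal \<bar>v y\<bar> + ennreal \<bar>v x\<bar> \<partial>m x) \<partial>\<nu>)"
    by (intro nn_integral_mono) (simp flip: ennreal_plus)
  also have "\<dots> = (\<integral>\<^sup>+x. (\<integral>\<^sup>+y. ennreal \<bar>v y\<bar> \<partial>m x) + ennreal \<bar>v x\<bar> \<partial>\<nu>)"
    by (simp add: nn_integral_add)
  also have "\<dots> = (\<integral>\<^sup>+x. ennreal \<bar>v x\<bar> \<partial>\<nu>) + (\<integral>\<^sup>+x. ennreal \<bar>v x\<bar> \<partial>\<nu>)"
    by (simp add: nn_integral_add nn_integral_invariant)
  also have "\<dots> < \<infinity>"
    using integrable_borel_version[OF u v uv] by (simp add: integrable_iff_bounded)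
  finally show ?thesis
    unfolding total_variation_cong_AE[OF uv] unfolding total_variation_eq
    by (simp add: less_top[symmetric] ennreal_divide_eq_top_iff)
qed

lemma total_variation_const[simp]: "total_variation m \<nu> (\<lambda>_. c) = 0"
  by (simp add: total_variation_eq)

text \<open>
  Zero total variation means that a step of the walk almost surely does not change \<open>u\<close>, so
  superlevel sets cannot be left and have zero or full measure. One of them suffices: if
  \<open>c\<close> is the mean of \<open>u\<close>, then \<open>u\<close> lies almost everywhere on one side of \<open>c\<close>, hence equals \<open>c\<close>.
\<close>

lemma AE_const_if_total_variation_0:
  assumes u: "integrable (completion \<nu>) u" and "total_variation m \<nu> u = 0"
  obtains c where "AE x in \<nu>. u x = c"
proof -
  obtain v where v[measurable]: "v \<in> borel_measurable borel" and uv: "AE x in \<nu>. u x = v x"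
    using obtain_borel_version u by blast
  have int_v: "integrable \<nu> v" by (rule integrable_borel_version[OF u v uv])
  have pos: "measure \<nu> UNIV > 0"
    using space by (simp add: reversible_ergodic_space_def emeasure_eq_measure zero_less_measure_iff)
  have "(\<integral>\<^sup>+x. (\<integral>\<^sup>+y. ennreal \<bar>v y - v x\<bar> \<partial>m x) \<partial>\<nu>) = 0"
    using assms(2) unfolding total_variation_cong_AE[OF uv] unfolding total_variation_eq
    by (simp add: ennreal_divide_eq_0_iff)
  then have "AE x in \<nu>. (\<integral>\<^sup>+y. ennreal \<bar>v y - v x\<bar> \<partial>m x) = 0"
    by (subst (asm) nn_integral_0_iff_AE) auto
  then have jump: "AE x in \<nu>. AE y in m x. v y = v x"
    by eventually_elim (subst (asm) nn_integral_0_iff_AE, auto)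
  define c where "c = (\<integral>x. v x \<partial>\<nu>) / measure \<nu> UNIV"
  have mean: "(\<integral>x. c - v x \<partial>\<nu>) = 0"
    using int_v pos by (simp add: c_def)
  define B where "B = {x. c < v x}"
  have [measurable]: "B \<in> sets borel" by (simp add: B_def)
  have "AE x in \<nu>. x \<in> B \<longrightarrow> emeasure (m x) B = 1"
    using jump
  proof eventually_elim
    case (elim x)
    interpret m: prob_space "m x" by (rule prob_space_m)
    show ?case
    proof
      assume "x \<in> B"
      with elim have "AE y in m x. y \<in> B" by (auto simp: B_def)
      then show "emeasure (m x) B = 1"
        by (subst (asm) m.AE_in_set_eq_1) (auto simp: m.emeasure_eq_measure)
    qed
  qed
  then have "(AE x in \<nu>. x \<notin> B) \<or> (AE x in \<nu>. x \<in> B)"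
    by (intro ergodic_AE) auto
  then have "AE x in \<nu>. c - v x = 0"
  proof
    assume "AE x in \<nu>. x \<notin> B"
    then have "AE x in \<nu>. 0 \<le> c - v x" by (simp add: B_def not_less)
    then show ?thesis
      using mean int_v by (subst (asm) integral_nonneg_eq_0_iff_AE) auto
  next
    assume "AE x in \<nu>. x \<in> B"
    then have "AE x in \<nu>. 0 \<le> v x - c" by (auto simp: B_def elim!: eventually_mono)
    moreover have "(\<integral>x. v x - c \<partial>\<nu>) = 0"
      using mean int_v by simp
    ultimately have "AE x in \<nu>. v x - c = 0"
      using int_v by (subst (asm) integral_nonneg_eq_0_iff_AE) auto
    then show ?thesis by eventually_elim simp
  qed
  with uv have "AE x in \<nu>. u x = c" by eventually_elim simp
  then show thesis by (rule that)
qed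

text \<open>
  A jump of the indicator leaves \<open>E\<close> or enters \<open>E\<close>; by reversibility both kinds have the same mass,
  which the factor \<open>1 / 2\<close> compensates.
\<close>

lemma perimeter_eq_total_variation:
  assumes E: "E \<in> sets (completion \<nu>)"
  shows "perimeter m \<nu> E = total_variation m \<nu> (indicator E)"
proof -
  define F where "F = main_part \<nu> E"
  have F[measurable]: "F \<in> sets borel"
    using main_part_sets[OF E] by (simp add: F_def)
  have EF: "AE x in \<nu>. x \<in> E \<longleftrightarrow> x \<in> F"
    using AE_in_main_part[OF E] by (auto simp: F_def elim!: eventually_mono)
  define p where "p = (\<integral>\<^sup>+x\<in>F. emeasure (m x) (UNIV - F) \<partial>\<nu>)"
  have "AE x in \<nu>. emeasure (completion (m x)) (UNIV - E) * indicator E x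
      = emeasure (m x) (UNIV - F) * indicator F x"
    using EF AE_kernel[OF EF]
  proof eventually_elim
    case (elim x)
    from elim(2) have "emeasure (completion (m x)) (UNIV - E) = emeasure (m x) (UNIV - F)"
      by (intro emeasure_completion_eq_AE) auto
    with elim(1) show ?case by (simp add: indicator_def)
  qed
  then have "perimeter m \<nu> E = p"
    unfolding perimeter_def p_def nn_integral_completion by (rule nn_integral_cong_AE)
  moreover have "total_variation m \<nu> (indicator E) = p"
  proof -
    have "AE x in \<nu>. indicator E x = (indicator F x :: real)"
      using EF by eventually_elim (simp add: indicator_def)
    then have "total_variation m \<nu> (indicator E) = total_variation m \<nu> (indicator F)"
      by (rule total_variation_cong_AE)
    also have "\<dots> = (\<integral>\<^sup>+x. emeasure (m x) (UNIV - F) * indicator F x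
        + emeasure (m x) F * indicator (UNIV - F) x \<partial>\<nu>) / 2"
    proof -
      have "(\<integral>\<^sup>+y. ennreal \<bar>indicator F y - indicator F x\<bar> \<partial>m x)
          = emeasure (m x) (UNIV - F) * indicator F x + emeasure (m x) F * indicator (UNIV - F) x"
        for x
      proof -
        have "(\<integral>\<^sup>+y. ennreal \<bar>indicator F y - indicator F x\<bar> \<partial>m x)
          = (\<integral>\<^sup>+y. indicator (if x \<in> F then UNIV - F else F) y \<partial>m x)"
          by (intro nn_integral_cong) (auto split: split_indicator)
        then show ?thesis by (auto split: split_indicator)
      qed
      then show ?thesis by (simp add: total_variation_eq)
    qed
    also have "\<dots> = (p + (\<integral>\<^sup>+x\<in>UNIV - F. emeasure (m x) F \<partial>\<nu>)) / 2"
      unfolding p_def by (subst nn_integral_add) auto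
    also have "\<dots> = (p + p) / 2"
      unfolding p_def by (simp add: reversible_Times[of F "UNIV - F"])
    also have "\<dots> = p"
      by (simp add: mult_2_right[symmetric] ennreal_mult_divide_eq)
    finally show ?thesis .
  qed
  ultimately show ?thesis by simp
qed

section \<open>Real-valued energy\<close>

definition tv :: "('a \<Rightarrow> real) \<Rightarrow> real" where
  "tv u = enn2real (total_variation m \<nu> u)"

definition deviation :: "('a \<Rightarrow> real) \<Rightarrow> ('a \<Rightarrow> real) \<Rightarrow> real" where
  "deviation f u = (\<integral>x. \<bar>u x - f x\<bar> \<partial>completion \<nu>)"

lemma tv_nonneg[simp]: "0 \<le> tv u"
  by (simp add: tv_def)

lemma tv_const[simp]: "tv (\<lambda>_. c) = 0"
  by (simp add: tv_def)

lemma ennreal_tv: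
  assumes "integrable (completion \<nu>) u"
  shows "ennreal (tv u) = total_variation m \<nu> u"
  using total_variation_finite[OF assms] by (simp add: tv_def)

lemma deviation_nonneg[simp]: "0 \<le> deviation f u"
  by (simp add: deviation_def)

lemma energy_eq:
  assumes "integrable (completion \<nu>) f" "integrable (completion \<nu>) u" "0 \<le> \<kappa>"
  shows "energy m \<nu> f \<kappa> u = ennreal (tv u + \<kappa> * deviation f u)"
proof -
  have "(\<integral>\<^sup>+x. ennreal \<bar>u x - f x\<bar> \<partial>completion \<nu>) = ennreal (deviation f u)"
    unfolding deviation_def using assms by (intro nn_integral_eq_integral) auto
  then show ?thesis
    using assms by (simp add: energy_def ennreal_tv[symmetric] ennreal_mult ennreal_plus)
qed

lemma minimizers_iff:
  assumes "integrable (completion \<nu>) f" "0 \<le> \<kappa>"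
  shows "u \<in> minimizers m \<nu> f \<kappa> \<longleftrightarrow> integrable (completion \<nu>) u \<and>
    (\<forall>v. integrable (completion \<nu>) v \<longrightarrow> tv u + \<kappa> * deviation f u \<le> tv v + \<kappa> * deviation f v)"
  using assms by (auto simp: minimizers_def energy_eq simp del: ennreal_plus)

lemma const_in_minimizers_iff:
  assumes "integrable (completion \<nu>) f" "0 \<le> \<kappa>"
  shows "(\<lambda>_. c) \<in> minimizers m \<nu> f \<kappa> \<longleftrightarrow>
    (\<forall>v. integrable (completion \<nu>) v \<longrightarrow> \<kappa> * (deviation f (\<lambda>_. c) - deviation f v) \<le> tv v)"
  using assms by (simp add: minimizers_iff algebra_simps)

lemma medians_iff:
  assumes f: "integrable (completion \<nu>) f"
  shows "c \<in> medians \<nu> f \<longleftrightarrow> (\<forall>d. deviation f (\<lambda>_. c) \<le> deviation f (\<lambda>_. d))"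
proof -
  have half: "emeasure (completion \<nu>) A \<le> emeasure \<nu> UNIV / 2 \<longleftrightarrow>
      measure (completion \<nu>) A \<le> measure (completion \<nu>) (space (completion \<nu>)) / 2" for A
  proof -
    have "emeasure \<nu> UNIV / 2 = ennreal (measure (completion \<nu>) UNIV / 2)"
      by (simp add: emeasure_eq_measure measure_completion ennreal_divide_numeral)
    then show ?thesis by (simp add: completion.emeasure_eq_measure del: ennreal_divide_numeral)
  qed
  show ?thesis
    using completion.median_iff_minimizes_abs_deviation[OF f, of c]
    by (simp add: medians_def half deviation_def)
qed

lemma deviation_cong_AE:
  assumes "integrable (completion \<nu>) f" "integrable (completion \<nu>) u"
    "integrable (completion \<nu>) v" "AE x in \<nu>. u x = v x"
  shows "deviation f u = deviation f v"
  unfolding deviation_def using assms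
  by (intro integral_cong_AE) (auto simp: AE_completion_iff elim!: eventually_mono)

lemma tv_cong_AE:
  "AE x in \<nu>. u x = v x \<Longrightarrow> tv u = tv v"
  using total_variation_cong_AE[of u v] by (simp add: tv_def)

section \<open>The threshold\<close>

text \<open>
  As \<open>\<kappa> < \<kappa>0\<close>, the inequalities \<open>\<kappa>0 * D u \<le> tv u \<le> \<kappa> * D u\<close> leave a minimizer \<open>u\<close> no room to
  gain deviation at the price of total variation. Conversely a median has the same energy as
  \<open>c\<close>, which is itself a median and still minimizes at \<open>\<kappa>\<close>.
\<close>

lemma minimizers_eq_median_functions:
  assumes f: "integrable (completion \<nu>) f"
    and c: "(\<lambda>_. c) \<in> minimizers m \<nu> f \<kappa>0"
    and \<kappa>: "0 < \<kappa>" "\<kappa> < \<kappa>0"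
  shows "minimizers m \<nu> f \<kappa> = median_functions \<nu> f"
proof -
  define D where "D v = deviation f (\<lambda>_. c) - deviation f v" for v
  have gain: "\<kappa>0 * D v \<le> tv v" if "integrable (completion \<nu>) v" for v
    using c that \<kappa> by (subst (asm) const_in_minimizers_iff) (auto simp: f D_def)
  have D_const: "D (\<lambda>_. d) \<le> 0" for d
    using gain[of "\<lambda>_. d"] \<kappa> by (simp add: mult_le_0_iff)
  have tv_gain: "\<kappa> * D v \<le> tv v" if "integrable (completion \<nu>) v" for v
  proof (cases "D v \<le> 0")
    case True
    then have "\<kappa> * D v \<le> 0" using \<kappa> by (simp add: mult_nonneg_nonpos)
    then show ?thesis using tv_nonneg[of v] by linarith
  next
    case False
    then have "\<kappa> * D v \<le> \<kappa>0 * D v" using \<kappa> by (intro mult_right_mono) auto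
    then show ?thesis using gain[OF that] by linarith
  qed
  have c_med: "c \<in> medians \<nu> f" using D_const by (auto simp: medians_iff f D_def)
  have "u \<in> median_functions \<nu> f" if "u \<in> minimizers m \<nu> f \<kappa>" for u
  proof -
    have u: "integrable (completion \<nu>) u" and
      min: "\<And>v. integrable (completion \<nu>) v \<Longrightarrow>
        tv u + \<kappa> * deviation f u \<le> tv v + \<kappa> * deviation f v"
      using that \<kappa> by (auto simp: minimizers_iff f)
    have le: "tv u \<le> \<kappa> * D u"
      using min[of "\<lambda>_. c"] by (simp add: D_def algebra_simps)
    then have "(\<kappa>0 - \<kappa>) * D u \<le> 0" using gain[OF u] by (simp add: algebra_simps)
    then have "D u \<le> 0" using \<kappa> by (simp add: mult_le_0_iff)
    then have "\<kappa> * D u \<le> 0" using \<kappa> by (simp add: mult_nonneg_nonpos)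
    with le have tv0: "tv u = 0" using tv_nonneg[of u] by linarith
    then have "0 \<le> D u" using le \<kappa> by (simp add: zero_le_mult_iff)
    have "total_variation m \<nu> u = 0" using ennreal_tv[OF u] tv0 by simp
    then obtain d where d: "AE x in \<nu>. u x = d"
      using AE_const_if_total_variation_0[OF u] by blast
    have "deviation f u = deviation f (\<lambda>_. d)"
      by (rule deviation_cong_AE) (use f u d in auto)
    then have "deviation f (\<lambda>_. d) \<le> deviation f (\<lambda>_. c)" using \<open>0 \<le> D u\<close> by (simp add: D_def)
    then have "d \<in> medians \<nu> f"
      using c_med by (auto simp: medians_iff f intro: order_trans)
    then show ?thesis using u d by (auto simp: median_functions_def AE_completion_iff)
  qed
  moreover have "u \<in> minimizers m \<nu> f \<kappa>" if med: "u \<in> median_functions \<nu> f" for u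
  proof -
    obtain d where u: "integrable (completion \<nu>) u" and d: "d \<in> medians \<nu> f"
      and ud: "AE x in \<nu>. u x = d"
      using med unfolding median_functions_def AE_completion_iff by blast
    have "deviation f u = deviation f (\<lambda>_. d)"
      by (rule deviation_cong_AE) (use f u ud in auto)
    also have "\<dots> = deviation f (\<lambda>_. c)"
      using c_med d by (auto simp: medians_iff f intro: antisym)
    finally have "deviation f u = deviation f (\<lambda>_. c)" .
    moreover have "tv u = 0" using tv_cong_AE[OF ud] by simp
    ultimately show ?thesis
      using tv_gain \<kappa> u by (auto simp: minimizers_iff f D_def algebra_simps)
  qed
  ultimately show ?thesis by blast
qed

text \<open>
  The set \<open>S\<close> of parameters for which \<open>c\<close> is optimal is cut out by inequalities linear in the
  parameter, so it is closed in \<open>{0<..}\<close>. Testing with \<open>f\<close> itself, which is strictly closer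
  to \<open>f\<close> than \<open>c\<close> is, bounds it by \<open>tv f / D f\<close>. The threshold is its maximum.
\<close>

lemma threshold:
  assumes f: "integrable (completion \<nu>) f"
    and ne: "\<not> (AE x in \<nu>. f x = c)"
    and "0 < \<kappa>" "(\<lambda>_. c) \<in> minimizers m \<nu> f \<kappa>"
  obtains \<kappa>0 where "0 < \<kappa>0" "(\<lambda>_. c) \<in> minimizers m \<nu> f \<kappa>0"
    "\<And>\<kappa>. \<kappa>0 < \<kappa> \<Longrightarrow> (\<lambda>_. c) \<notin> minimizers m \<nu> f \<kappa>"
proof -
  define S where "S = {\<kappa>. 0 < \<kappa> \<and> (\<lambda>_. c) \<in> minimizers m \<nu> f \<kappa>}"
  define D where "D v = deviation f (\<lambda>_. c) - deviation f v" for v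
  have S: "\<kappa> \<in> S \<longleftrightarrow> 0 < \<kappa> \<and> (\<forall>v. integrable (completion \<nu>) v \<longrightarrow> \<kappa> * D v \<le> tv v)" for \<kappa>
    by (auto simp: S_def const_in_minimizers_iff f D_def)
  have "deviation f (\<lambda>_. c) \<noteq> 0"
  proof
    assume "deviation f (\<lambda>_. c) = 0"
    then have "AE x in completion \<nu>. \<bar>c - f x\<bar> = 0"
      unfolding deviation_def using f by (subst (asm) integral_nonneg_eq_0_iff_AE) auto
    then have "AE x in \<nu>. \<bar>c - f x\<bar> = 0" by (simp only: AE_completion_iff)
    then have "AE x in \<nu>. f x = c" by eventually_elim linarith
    with ne show False by (rule notE)
  qed
  then have "0 < D f" by (simp add: D_def deviation_def order.strict_iff_order)
  then have bdd: "bdd_above S"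
    using f by (intro bdd_aboveI[of _ "tv f / D f"]) (auto simp: S pos_le_divide_eq)
  have "\<kappa> \<in> S" using assms by (simp add: S_def)
  then have "\<kappa> \<le> Sup S" using bdd by (rule cSup_upper)
  with \<open>0 < \<kappa>\<close> have pos: "0 < Sup S" by linarith
  have "Sup S * D v \<le> tv v" if v: "integrable (completion \<nu>) v" for v
  proof (cases "0 < D v")
    case True
    then have "\<kappa>' \<le> tv v / D v" if "\<kappa>' \<in> S" for \<kappa>' using that v by (auto simp: S pos_le_divide_eq)
    then have "Sup S \<le> tv v / D v" using \<open>\<kappa> \<in> S\<close> by (intro cSup_least) auto
    then show ?thesis using True by (simp add: pos_le_divide_eq)
  next
    case False
    then have "Sup S * D v \<le> 0" using pos by (simp add: mult_nonneg_nonpos)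
    then show ?thesis using tv_nonneg[of v] by linarith
  qed
  then have "Sup S \<in> S" using pos by (simp add: S)
  show thesis
  proof (rule that[of "Sup S"])
    show "0 < Sup S" by (rule pos)
    show "(\<lambda>_. c) \<in> minimizers m \<nu> f (Sup S)" using \<open>Sup S \<in> S\<close> unfolding S_def by blast
    fix \<kappa>' assume less: "Sup S < \<kappa>'"
    show "(\<lambda>_. c) \<notin> minimizers m \<nu> f \<kappa>'"
    proof
      assume "(\<lambda>_. c) \<in> minimizers m \<nu> f \<kappa>'"
      then have "\<kappa>' \<in> S" using pos less by (simp add: S_def)
      then show False using cSup_upper[OF _ bdd] less by (meson not_le)
    qed
  qed
qed

text \<open>
  The sign \<open>\<sigma>\<close> covers functions above and below \<open>c\<close> at once. The competitor
  \<open>c + \<sigma> * indicator E\<close> gains exactly the mass of \<open>E\<close> in deviation and pays its perimeter.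
\<close>

lemma le_cheeger_constant:
  assumes A: "A \<in> sets (completion \<nu>)" and \<sigma>: "\<bar>\<sigma>\<bar> = 1"
    and \<kappa>: "0 < \<kappa>" "(\<lambda>_. c) \<in> minimizers m \<nu> (\<lambda>x. c + \<sigma> * indicator A x) \<kappa>"
  shows "ennreal \<kappa> \<le> cheeger_constant m \<nu> A"
  unfolding cheeger_constant_def
proof (rule Inf_greatest, safe)
  fix E assume E: "E \<subseteq> A" "E \<in> sets (completion \<nu>)" "0 < emeasure (completion \<nu>) E"
  have int: "integrable (completion \<nu>) (\<lambda>x. c + \<sigma> * indicator B x)"
    if "B \<in> sets (completion \<nu>)" for B
    using that by (intro Bochner_Integration.integrable_add integrable_mult_right)
      (auto simp: less_top[symmetric])
  define f where "f = (\<lambda>x. c + \<sigma> * indicator A x)"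
  define v where "v = (\<lambda>x. c + \<sigma> * indicator E x)"
  have "deviation f (\<lambda>_. c) = (\<integral>x. indicator A x \<partial>completion \<nu>)"
    unfolding deviation_def f_def using \<sigma>
    by (intro Bochner_Integration.integral_cong) (auto split: split_indicator)
  also have "\<dots> = measure (completion \<nu>) A" using A by simp
  finally have dev_c: "deviation f (\<lambda>_. c) = measure (completion \<nu>) A" .
  have "deviation f v = (\<integral>x. indicator (A - E) x \<partial>completion \<nu>)"
    unfolding deviation_def f_def v_def using \<sigma> E(1)
    by (intro Bochner_Integration.integral_cong) (auto split: split_indicator)
  also have "\<dots> = measure (completion \<nu>) (A - E)" using A E by simp
  also have "\<dots> = measure (completion \<nu>) A - measure (completion \<nu>) E"
    using A E by (intro completion.finite_measure_Diff) auto
  finally have dev_v: "deviation f v = measure (completion \<nu>) A - measure (completion \<nu>) E" .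
  have "\<bar>v y - v x\<bar> = \<bar>indicator E y - indicator E x\<bar>" for x y
    using \<sigma> by (auto simp: v_def split: split_indicator)
  then have "total_variation m \<nu> v = perimeter m \<nu> E"
    by (simp add: perimeter_eq_total_variation E total_variation_eq)
  moreover have "\<kappa> * measure (completion \<nu>) E \<le> tv v"
    using \<kappa> dev_c dev_v int[OF A] int[OF E(2)]
    by (fold f_def v_def) (auto simp: const_in_minimizers_iff)
  ultimately have "ennreal (\<kappa> * measure (completion \<nu>) E) \<le> perimeter m \<nu> E"
    using ennreal_tv[of v] int[OF E(2)] by (fold v_def) (metis ennreal_leI)
  then have "ennreal \<kappa> * emeasure (completion \<nu>) E \<le> perimeter m \<nu> E"
    using \<kappa> by (simp add: completion.emeasure_eq_measure ennreal_mult)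
  then have "ennreal \<kappa> * emeasure (completion \<nu>) E / emeasure (completion \<nu>) E
      \<le> perimeter m \<nu> E / emeasure (completion \<nu>) E"
    by (rule divide_right_mono_ennreal)
  then show "ennreal \<kappa> \<le> perimeter m \<nu> E / emeasure (completion \<nu>) E"
    using E(3) completion.emeasure_finite[of E] by (simp add: ennreal_mult_divide_eq)
qed

end

theorem proposition3p31:
  fixes m :: "'a::polish_space \<Rightarrow> 'a measure"
    and \<nu> :: "'a measure"
    and \<Omega> :: "'a set"
  assumes "reversible_ergodic_space m \<nu>"
    and "\<Omega> \<in> sets (completion \<nu>)"
    and "0 < emeasure (completion \<nu>) \<Omega>"
    and "emeasure (completion \<nu>) \<Omega> < emeasure \<nu> UNIV"
  shows
    "((\<exists>\<kappa>>0. (\<lambda>_. 0) \<in> minimizers m \<nu> (indicator \<Omega>) \<kappa>) \<longrightarrow>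
       (\<exists>\<kappa>0::real. 0 < \<kappa>0 \<and> ennreal \<kappa>0 \<le> cheeger_constant m \<nu> \<Omega> \<and>
          (\<forall>\<kappa>. 0 < \<kappa> \<and> \<kappa> < \<kappa>0 \<longrightarrow>
             median_functions \<nu> (indicator \<Omega>) = minimizers m \<nu> (indicator \<Omega>) \<kappa>) \<and>
          (\<lambda>_. 0) \<in> minimizers m \<nu> (indicator \<Omega>) \<kappa>0 \<and>
          (\<forall>\<kappa>>\<kappa>0. (\<lambda>_. 0) \<notin> minimizers m \<nu> (indicator \<Omega>) \<kappa>))) \<and>
     ((\<exists>\<kappa>>0. (\<lambda>_. 1) \<in> minimizers m \<nu> (indicator \<Omega>) \<kappa>) \<longrightarrow>
       (\<exists>\<kappa>1::real. 0 < \<kappa>1 \<and> ennreal \<kappa>1 \<le> cheeger_constant m \<nu> (UNIV - \<Omega>) \<and>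
          (\<forall>\<kappa>. 0 < \<kappa> \<and> \<kappa> < \<kappa>1 \<longrightarrow>
             median_functions \<nu> (indicator \<Omega>) = minimizers m \<nu> (indicator \<Omega>) \<kappa>) \<and>
          (\<lambda>_. 1) \<in> minimizers m \<nu> (indicator \<Omega>) \<kappa>1 \<and>
          (\<forall>\<kappa>>\<kappa>1. (\<lambda>_. 1) \<notin> minimizers m \<nu> (indicator \<Omega>) \<kappa>)))"
proof -
  interpret ergodic_walk m \<nu> by unfold_locales (rule assms(1))
  let ?\<chi> = "indicator \<Omega> :: 'a \<Rightarrow> real"
  have int: "integrable (completion \<nu>) ?\<chi>"
    using assms(2) by (simp add: less_top[symmetric])
  have not_0: "\<not> (AE x in \<nu>. ?\<chi> x = 0)"
  proof
    assume "AE x in \<nu>. ?\<chi> x = 0"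
    then have "AE x in \<nu>. x \<in> \<Omega> \<longleftrightarrow> x \<in> {}" by eventually_elim (simp add: indicator_eq_0_iff)
    then have "emeasure (completion \<nu>) \<Omega> = emeasure \<nu> {}"
      by (rule emeasure_completion_eq_AE) auto
    then show False using assms(3) by simp
  qed
  have not_1: "\<not> (AE x in \<nu>. ?\<chi> x = 1)"
  proof
    assume "AE x in \<nu>. ?\<chi> x = 1"
    then have "AE x in \<nu>. x \<in> \<Omega> \<longleftrightarrow> x \<in> UNIV" by eventually_elim (simp add: indicator_eq_1_iff)
    then have "emeasure (completion \<nu>) \<Omega> = emeasure \<nu> UNIV"
      by (rule emeasure_completion_eq_AE) auto
    then show False using assms(4) by simp
  qed
  have main: "\<exists>\<kappa>0>0. ennreal \<kappa>0 \<le> cheeger_constant m \<nu> A \<and>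
      (\<forall>\<kappa>. 0 < \<kappa> \<and> \<kappa> < \<kappa>0 \<longrightarrow> median_functions \<nu> ?\<chi> = minimizers m \<nu> ?\<chi> \<kappa>) \<and>
      (\<lambda>_. c) \<in> minimizers m \<nu> ?\<chi> \<kappa>0 \<and> (\<forall>\<kappa>>\<kappa>0. (\<lambda>_. c) \<notin> minimizers m \<nu> ?\<chi> \<kappa>)"
    if c: "\<not> (AE x in \<nu>. ?\<chi> x = c)" and ex: "\<exists>\<kappa>>0. (\<lambda>_. c) \<in> minimizers m \<nu> ?\<chi> \<kappa>"
      and A: "A \<in> sets (completion \<nu>)" "\<bar>\<sigma>\<bar> = 1" "?\<chi> = (\<lambda>x. c + \<sigma> * indicator A x)"
    for A c \<sigma>
  proof -
    obtain \<kappa>0 where \<kappa>0: "0 < \<kappa>0" "(\<lambda>_. c) \<in> minimizers m \<nu> ?\<chi> \<kappa>0"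
      "\<And>\<kappa>. \<kappa>0 < \<kappa> \<Longrightarrow> (\<lambda>_. c) \<notin> minimizers m \<nu> ?\<chi> \<kappa>"
      using threshold[OF int c] ex by blast
    have "ennreal \<kappa>0 \<le> cheeger_constant m \<nu> A"
      using \<kappa>0(2) unfolding A(3) by (intro le_cheeger_constant[OF A(1,2) \<kappa>0(1)])
    then show ?thesis
      using \<kappa>0 minimizers_eq_median_functions[OF int \<kappa>0(2)] by (intro exI[of _ \<kappa>0]) auto
  qed
  have compl: "UNIV - \<Omega> \<in> sets (completion \<nu>)"
    using sets.compl_sets[OF assms(2)] by simp
  have \<chi>_0: "?\<chi> = (\<lambda>x. 0 + 1 * indicator \<Omega> x)"
    and \<chi>_1: "?\<chi> = (\<lambda>x. 1 + (- 1) * indicator (UNIV - \<Omega>) x)"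
    by (simp_all add: fun_eq_iff indicator_def)
  show ?thesis
    by (intro conjI impI main[OF not_0 _ assms(2) _ \<chi>_0] main[OF not_1 _ compl _ \<chi>_1]) simp_all
qed

end
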